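(* Let $q$ be a prime power, let $n\ge k\ge1$ be integers, let $\mathcal{C}$ be an $[n,k]_q$ code and let $c=(c_1,\dots,c_n)\in\mathcal{C}$ be a maximal codeword. For every $j\in\sigma(c)$ there exist a set $I_j\subseteq\sigma(c)\setminus\{j\}$ of cardinality $(q-1)(k-1)$ and a codeword $z\in\mathcal{C}$ such that $\sigma(z)\cap\sigma(c)\supseteq I_j$.
   Context: For $v\in\mathbb{F}_q^n$, the support is $\sigma(v)=\{i : v_i\ne 0\}\subseteq\{1,\dots,n\}$. An $[n,k]_q$ code is an $\mathbb{F}_q$-linear subspace $\mathcal{C}\subseteq\mathbb{F}_q^n$ of dimension $k\ge1$. A nonzero codeword $c\in\mathcal{C}$ is maximal if every $c'\in\mathcal{C}$ with $\sigma(c')\supseteq\sigma(c)$ is a scalar multiple of $c$. *)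

theory Defs
  imports "HOL-Analysis.Cartesian_Space"
begin

text \<open>The space $\mathbb{F}_q^n$ is rendered as \<open>'a ^ 'n\<close> with \<open>'a\<close> a finite field of
  cardinality $q$ and \<open>'n\<close> a finite index type of cardinality $n$. Subspaces and dimension are
  those of the vector space of tuples over the field \<open>'a\<close> (with scalar multiplication \<open>*s\<close>).\<close>

definition support :: "'a::zero ^ 'n \<Rightarrow> 'n set" where
  "support v = {i. v $ i \<noteq> 0}"

definition linear_code :: "nat \<Rightarrow> nat \<Rightarrow> nat \<Rightarrow> ('a::{field,finite} ^ 'n) set \<Rightarrow> bool" where
  "linear_code q n k C \<longleftrightarrow>
     CARD('a) = q \<and> CARD('n) = n \<and> vec.subspace C \<and> vec.dim C = k \<and> k \<ge> 1"

definition maximal_codeword :: "('a::{field,finite} ^ 'n) set \<Rightarrow> 'a ^ 'n \<Rightarrow> bool" where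
  "maximal_codeword C c \<longleftrightarrow>
     c \<in> C \<and> c \<noteq> 0 \<and> (\<forall>c'\<in>C. support c \<subseteq> support c' \<longrightarrow> (\<exists>a. c' = a *s c))"

end

theory Submission
  imports Defs "HOL-Computational_Algebra.Polynomial"
begin

text \<open>It suffices to show that \<open>c\<close> has weight at least \<open>(q - 1) * (k - 1) + 1\<close>, since then
  \<open>z = c\<close> works. The words of the code that vanish at \<open>j\<close> form a complement \<open>W\<close> of the line
  spanned by \<open>c\<close>. By maximality, \<open>w - c\<close> vanishes somewhere on the support of \<open>c\<close> for every
  nonzero \<open>w\<close> in \<open>W\<close>, so the product of the affine functions \<open>w \<mapsto> w i - c i\<close>, with \<open>i\<close> ranging
  over the support of \<open>c\<close> without \<open>j\<close>, is nonzero on \<open>W\<close> exactly at the origin. Its sum over \<open>W\<close>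
  is therefore nonzero, whereas, as in the Chevalley-Warning theorem, a product of fewer than
  \<open>(q - 1) * dim W\<close> affine functions sums to zero. This is Jamison's bound for affine blocking
  sets.\<close>

text \<open>Replacing \<open>t\<close> by \<open>a * t\<close> multiplies the sum by
  \<open>a ^ s\<close>, so it vanishes once some nonzero \<open>a\<close> has
  \<open>a ^ s \<noteq> 1\<close>. For \<open>s = 0\<close> no such \<open>a\<close> exists and a
  translation is used instead.\<close>

lemma sum_power_finite_field_eq_0:
  fixes s :: nat
  assumes "s < CARD('a::{field,finite}) - 1"
  shows "(\<Sum>t\<in>(UNIV :: 'a set). t ^ s) = 0"
proof (cases "s = 0")
  case True
  \<comment> \<open>Cancelling in this identity leaves q times 1 equal to 0, which is the claim
    because \<open>0 ^ 0 = 1\<close>.\<close>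
  have "(\<Sum>t\<in>(UNIV :: 'a set). t) = (\<Sum>t\<in>(UNIV :: 'a set). t + 1)"
    by (rule sum.reindex_bij_witness[of _ "\<lambda>t. t + 1" "\<lambda>t. t - 1"]) auto
  then show ?thesis
    using True by (simp add: sum.distrib)
next
  case False
  \<comment> \<open>Otherwise X^s - 1 would have q - 1 roots, more than its degree allows.\<close>
  obtain a :: 'a where a: "a \<noteq> 0" "a ^ s \<noteq> 1"
  proof (rule ccontr)
    assume "\<not> thesis"
    then have all: "a ^ s = 1" if "a \<noteq> 0" for a :: 'a
      using that \<open>\<And>a. a \<noteq> 0 \<Longrightarrow> a ^ s \<noteq> 1 \<Longrightarrow> thesis\<close> by blast
    define p :: "'a poly" where "p = monom 1 s - 1"
    have "coeff p s = 1"
      using False by (simp add: p_def coeff_1)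
    then have p0: "p \<noteq> 0" by auto
    have "degree p \<le> s"
      unfolding p_def by (intro degree_diff_le) (auto simp: degree_monom_le)
    have "UNIV - {0} \<subseteq> {x. poly p x = 0}"
      using all by (auto simp: p_def poly_monom)
    then have "card (UNIV - {0::'a}) \<le> card {x. poly p x = 0}"
      by (intro card_mono) auto
    also have "\<dots> \<le> degree p"
      by (rule card_poly_roots_bound[OF p0])
    finally show False
      using assms \<open>degree p \<le> s\<close> by (simp add: card_Diff_singleton)
  qed
  have "(\<Sum>t\<in>(UNIV :: 'a set). t ^ s) = (\<Sum>t\<in>(UNIV :: 'a set). (a * t) ^ s)"
    by (rule sum.reindex_bij_witness[of _ "\<lambda>t. a * t" "\<lambda>t. t / a"]) (use a in auto)
  also have "\<dots> = a ^ s * (\<Sum>t\<in>(UNIV :: 'a set). t ^ s)"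
    by (simp add: power_mult_distrib sum_distrib_left)
  finally show ?thesis
    using a by simp
qed

text \<open>As \<open>e\<close> lies outside the span of \<open>B\<close>, each vector of the larger
  span is \<open>w + t *s e\<close> for exactly one pair \<open>(t, w)\<close>.\<close>

lemma sum_span_insert:
  fixes e :: "'a::{field,finite} ^ 'n" and f :: "'a ^ 'n \<Rightarrow> 'b::comm_monoid_add"
  assumes "e \<notin> vec.span B"
  shows "(\<Sum>w\<in>vec.span (insert e B). f w) = (\<Sum>t\<in>UNIV. \<Sum>w\<in>vec.span B. f (w + t *s e))"
proof -
  have inj: "inj_on (\<lambda>(t, w). w + t *s e) (UNIV \<times> vec.span B)"
  proof (clarsimp simp: inj_on_def)
    fix t t' w w'
    assume w: "w \<in> vec.span B" "w' \<in> vec.span B" and eq: "w + t *s e = w' + t' *s e"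
    have diff: "(t - t') *s e = w' - w"
      using eq by (simp add: vec.scale_left_diff_distrib algebra_simps)
    have "t = t'"
    proof (rule ccontr)
      assume "t \<noteq> t'"
      have "(1 / (t - t')) *s ((t - t') *s e) \<in> vec.span B"
        unfolding diff by (intro vec.span_scale vec.span_diff w)
      then show False
        using \<open>t \<noteq> t'\<close> assms by (simp add: vec.scale_scale)
    qed
    then show "t = t' \<and> w = w'"
      using eq by simp
  qed
  have image: "vec.span (insert e B) = (\<lambda>(t, w). w + t *s e) ` (UNIV \<times> vec.span B)"
  proof (rule set_eqI)
    fix x
    have "x \<in> vec.span (insert e B) \<longleftrightarrow> (\<exists>t. x - t *s e \<in> vec.span B)"
      by (simp add: vec.span_insert)
    also have "\<dots> \<longleftrightarrow> x \<in> (\<lambda>(t, w). w + t *s e) ` (UNIV \<times> vec.span B)"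
    proof
      assume "\<exists>t. x - t *s e \<in> vec.span B"
      then obtain t where "x - t *s e \<in> vec.span B" ..
      then show "x \<in> (\<lambda>(t, w). w + t *s e) ` (UNIV \<times> vec.span B)"
        by (intro image_eqI[of _ _ "(t, x - t *s e)"]) auto
    qed (clarsimp, metis add_diff_cancel_right')
    finally show "x \<in> vec.span (insert e B) \<longleftrightarrow>
        x \<in> (\<lambda>(t, w). w + t *s e) ` (UNIV \<times> vec.span B)" .
  qed
  show ?thesis
    unfolding image by (subst sum.reindex[OF inj]) (simp add: sum.cartesian_product case_prod_unfold)
qed

text \<open>Induction on the basis, with \<open>D\<close> arbitrary because the expansion in
  \<open>t\<close> passes to subsets of \<open>D\<close>. A term with a low power of
  \<open>t\<close> dies in the sum over \<open>t\<close>; a high power uses up so many factors that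
  the induction hypothesis kills the rest.\<close>

lemma sum_span_prod_affine_eq_0:
  fixes B :: "('a::{field,finite} ^ 'n) set" and b :: "'n \<Rightarrow> 'a"
  assumes "finite B" and "vec.independent B"
    and "card D < (CARD('a) - 1) * card B"
  shows "(\<Sum>w\<in>vec.span B. \<Prod>i\<in>D. w $ i + b i) = 0"
  using assms
proof (induction B arbitrary: D rule: finite_induct)
  case empty
  then show ?case by simp
next
  case (insert e B)
  have e: "e \<notin> vec.span B" and ind: "vec.independent B"
    using insert.prems(1) insert.hyps(2) by (auto simp: vec.independent_insert)
  have "(\<Sum>w\<in>vec.span (insert e B). \<Prod>i\<in>D. w $ i + b i) =
      (\<Sum>t\<in>UNIV. \<Sum>w\<in>vec.span B. \<Prod>i\<in>D. t * e $ i + (w $ i + b i))"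
    by (simp add: sum_span_insert[OF e] add_ac)
  \<comment> \<open>\<open>S\<close> is the set of factors from which the summand
    \<open>t * e $ i\<close> is chosen.\<close>
  also have "\<dots> = (\<Sum>t\<in>UNIV. \<Sum>w\<in>vec.span B. \<Sum>S\<in>Pow D.
      t ^ card S * (\<Prod>i\<in>S. e $ i) * (\<Prod>i\<in>D - S. w $ i + b i))"
    by (simp add: prod_add prod.distrib)
  also have "\<dots> = (\<Sum>t\<in>UNIV. \<Sum>S\<in>Pow D. \<Sum>w\<in>vec.span B.
      t ^ card S * (\<Prod>i\<in>S. e $ i) * (\<Prod>i\<in>D - S. w $ i + b i))"
    by (intro sum.cong refl sum.swap)
  also have "\<dots> = (\<Sum>S\<in>Pow D. \<Sum>t\<in>UNIV. \<Sum>w\<in>vec.span B.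
      t ^ card S * (\<Prod>i\<in>S. e $ i) * (\<Prod>i\<in>D - S. w $ i + b i))"
    by (rule sum.swap)
  also have "\<dots> = (\<Sum>S\<in>Pow D. (\<Sum>t\<in>UNIV. t ^ card S) * (\<Prod>i\<in>S. e $ i) *
      (\<Sum>w\<in>vec.span B. \<Prod>i\<in>D - S. w $ i + b i))"
    by (simp add: sum_distrib_left sum_distrib_right mult_ac) (intro sum.cong refl sum.swap)
  also have "\<dots> = 0"
  proof (rule sum.neutral, rule ballI)
    fix S assume S: "S \<in> Pow D"
    show "(\<Sum>t\<in>UNIV. t ^ card S) * (\<Prod>i\<in>S. e $ i) *
        (\<Sum>w\<in>vec.span B. \<Prod>i\<in>D - S. w $ i + b i) = 0"
    proof (cases "card S < CARD('a) - 1")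
      case True
      then show ?thesis
        by (simp add: sum_power_finite_field_eq_0)
    next
      case False
      have "card (D - S) = card D - card S"
        using S by (intro card_Diff_subset) auto
      moreover have "card S \<le> card D"
        using S by (intro card_mono) auto
      ultimately have "card (D - S) < (CARD('a) - 1) * card B"
        using False insert.prems(2) insert.hyps by simp
      then show ?thesis
        using insert.IH[OF ind] by simp
    qed
  qed
  finally show ?case .
qed

lemma maximal_codeword_weight:
  fixes C :: "('a::{field,finite} ^ 'n) set"
  assumes C: "vec.subspace C" and c: "maximal_codeword C c" and j: "j \<in> support c"
  shows "(CARD('a) - 1) * (vec.dim C - 1) \<le> card (support c - {j})"
proof (rule ccontr)
  assume less: "\<not> ?thesis"
  have cC: "c \<in> C"
    using c by (simp add: maximal_codeword_def)
  have cj: "c $ j \<noteq> 0"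
    using j by (simp add: support_def)
  define W where "W = {x \<in> C. x $ j = 0}"
  have W: "vec.subspace W"
    using C by (auto simp: W_def vec.subspace_def)
  obtain B where B: "B \<subseteq> W" "vec.independent B" "W \<subseteq> vec.span B" "card B = vec.dim W"
    using vec.basis_exists by blast
  have spanB: "vec.span B = W"
    using B W vec.span_subspace by blast
  have "C \<subseteq> vec.span (insert c B)"
  proof
    fix x assume "x \<in> C"
    \<comment> \<open>The multiple of \<open>c\<close> is chosen to clear coordinate
      \<open>j\<close>. Hence \<open>c\<close> and \<open>B\<close> span the code, and
      \<open>B\<close> has at least k - 1 elements.\<close>
    then have "x - (x $ j / c $ j) *s c \<in> W"
      using cj cC C by (simp add: W_def vec.subspace_diff vec.subspace_scale)
    then show "x \<in> vec.span (insert c B)"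
      by (auto simp: vec.span_insert spanB)
  qed
  then have "vec.dim C \<le> card (insert c B)"
    by (rule vec.dim_le_card) simp
  also have "\<dots> \<le> Suc (card B)"
    by (rule card_insert_le_m1) auto
  finally have dim: "vec.dim C - 1 \<le> card B"
    by simp
  have zero: "(\<Prod>i\<in>support c - {j}. w $ i + - c $ i) = 0" if w: "w \<in> W - {0}" for w
  proof -
    \<comment> \<open>Otherwise maximality makes \<open>w\<close> a multiple of \<open>c\<close>; as
      \<open>w\<close> vanishes at \<open>j\<close> and \<open>c\<close> does not, \<open>w\<close>
      would be 0.\<close>
    have "\<not> support c \<subseteq> support (w - c)"
    proof
      assume sub: "support c \<subseteq> support (w - c)"
      have "w - c \<in> C"
        using w cC C by (auto simp: W_def vec.subspace_diff)
      then obtain a where a: "w - c = a *s c"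
        using c sub by (auto simp: maximal_codeword_def)
      then have weq: "w = (a + 1) *s c"
        by (simp add: vec.scale_left_distrib algebra_simps)
      have "w $ j = 0"
        using w by (simp add: W_def)
      then have "a + 1 = 0"
        using cj unfolding weq by simp
      then show False
        using w weq by simp
    qed
    then obtain i where i: "i \<in> support c" "w $ i = c $ i"
      by (auto simp: support_def)
    \<comment> \<open>Since \<open>w $ j = 0\<close>, the factor at \<open>j\<close> never vanishes
      on \<open>W\<close>, so leaving it out costs nothing.\<close>
    moreover have "i \<noteq> j"
      using i cj w by (auto simp: W_def)
    ultimately show ?thesis
      by (intro prod_zero) auto
  qed
  have "card (support c - {j}) < (CARD('a) - 1) * (vec.dim C - 1)"
    using less by simp
  also have "\<dots> \<le> (CARD('a) - 1) * card B"
    using dim by simp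
  finally have "(\<Sum>w\<in>W. \<Prod>i\<in>support c - {j}. w $ i + - c $ i) = 0"
    using sum_span_prod_affine_eq_0[of B "support c - {j}" "\<lambda>i. - c $ i"] B(2)
    by (simp add: spanB)
  \<comment> \<open>Only the origin contributes, and its term is a product of nonzero entries
    \<open>- c $ i\<close>.\<close>
  moreover have "(\<Sum>w\<in>W. \<Prod>i\<in>support c - {j}. w $ i + - c $ i) =
      (\<Prod>i\<in>support c - {j}. 0 $ i + - c $ i)"
    using zero vec.subspace_0[OF W] by (subst sum.remove[of _ 0]) (simp_all del: prod_zero_iff add: sum.neutral)
  ultimately show False
    by (auto simp: support_def)
qed

theorem theorem2p13:
  fixes C :: "('a::{field,finite} ^ 'n) set" and c :: "'a ^ 'n" and q n k :: nat
  assumes "1 \<le> k" and "k \<le> n"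
    and "linear_code q n k C"
    and "maximal_codeword C c"
  shows "\<forall>j\<in>support c. \<exists>I z. I \<subseteq> support c - {j} \<and> card I = (q - 1) * (k - 1) \<and>
           z \<in> C \<and> I \<subseteq> support z \<inter> support c"
proof
  fix j assume "j \<in> support c"
  then have "(q - 1) * (k - 1) \<le> card (support c - {j})"
    using maximal_codeword_weight[of C c j] assms(3,4) by (auto simp: linear_code_def)
  then obtain I where I: "I \<subseteq> support c - {j}" "card I = (q - 1) * (k - 1)"
    by (meson obtain_subset_with_card_n)
  moreover have "c \<in> C"
    using assms(4) by (simp add: maximal_codeword_def)
  ultimately show "\<exists>I z. I \<subseteq> support c - {j} \<and> card I = (q - 1) * (k - 1) \<and>
      z \<in> C \<and> I \<subseteq> support z \<inter> support c"
    by blast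
qed

end
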